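(* There exists a dynamic sequential team with only two decision makers ($N=2$) such that: (a) $E\big[\int f(z)\,\pi_{n+1}(dz)\,\big|\,\pi_n,\hat\gamma^n\big]$ is weakly continuous in $(\pi_n,\hat\gamma^n)$ for every continuous and bounded $f$; (b) all of the measurement spaces and action spaces, and $\Omega_0$, are compact; (c) the cost function $c$ is continuous; and yet no optimal team policy exists. That is, conditions (a)–(c) are not sufficient for the existence of an optimal team policy.
   Context: Sequential team: there are $N$ decision makers (DMs) acting in the order $1,\dots,N$. $\Omega_0$, the measurement spaces $\mathbb{Y}^t$ and the action spaces $\mathbb{U}^t$ are standard Borel. A random variable $\omega_0\in\Omega_0$ has a given law, and for each $t$ the measurement $y^t\in\mathbb{Y}^t$ is generated from $(\omega_0,y^1,\dots,y^{t-1},u^1,\dots,u^{t-1})$ by a given stochastic kernel $P(dy^t\mid\omega_0,y^1,\dots,y^{t-1},u^1,\dots,u^{t-1})$. The team is dynamic if the measurement of at least one DM is affected by the action of another DM. DM $t$ observes only $y^t$ and applies $u^t=\gamma^t(y^t)\in\mathbb{U}^t$ with $\gamma^t$ measurable; $\underline\gamma=(\gamma^1,\dots,\gamma^N)$ is a team policy. The cost is $J(\underline\gamma)=E^{\underline\gamma}[c(\omega_0,u^1,\dots,u^N)]$ with $c\ge0$ measurable; $\underline\gamma^*$ is optimal if $J(\underline\gamma^* )=\inf_{\underline\gamma}J(\underline\gamma)$. Extended state and action: let $x_n=(\omega_0,u^1,\dots,u^{n-1},y^1,\dots,y^n)$. The extended state $\pi_n$ is a probability measure on $\Omega_0\times\prod_{i=1}^n\mathbb{Y}^i\times\prod_{i=1}^{n-1}\mathbb{U}^i$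 (law of $x_n$). Given $\pi_n$, an action $\hat\gamma^n$ is a probability measure on $\Omega_0\times\prod_{i=1}^n\mathbb{Y}^i\times\prod_{i=1}^n\mathbb{U}^i$ (law of $(x_n,u^n)$) under which $x_n\sim\pi_n$ and $u^n$ is conditionally independent of $x_n$ given $y^n$. The next state $\pi_{n+1}$ is the law of $x_{n+1}=(x_n,u^n,y^{n+1})$ when $(x_n,u^n)\sim\hat\gamma^n$ and $y^{n+1}\sim P(dy^{n+1}\mid\omega_0,y^1,\dots,y^n,u^1,\dots,u^n)$, for $1\le n\le N-1$; it is a deterministic function of $(\pi_n,\hat\gamma^n)$. Weak continuity means continuity when the spaces of probability measures carry the topology of weak convergence. *)

theory Defs
  imports "HOL-Probability.Probability"
begin

section \<open>Probability measures with the topology of weak convergence\<close>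

text \<open>The coarsest topology that makes every integral of a bounded continuous function continuous.
  \<open>M\<close> carries the Borel sets of \<open>X\<close>.\<close>

definition weak_topology :: "'a measure \<Rightarrow> 'a topology \<Rightarrow> 'a measure topology" where
  "weak_topology M X = topology_generated_by
     {{\<mu> \<in> space (prob_algebra M). (\<integral>x. f x \<partial>\<mu>) \<in> V} | f V.
        continuous_map X euclideanreal f \<and> bounded (f ` topspace X) \<and> open V}"

text \<open>The random elements \<open>X\<close> and \<open>Z\<close> are conditionally independent given \<open>W\<close>.\<close>

definition cond_indep ::
  "'a measure \<Rightarrow> 'b measure \<Rightarrow> ('a \<Rightarrow> 'b) \<Rightarrow> 'c measure \<Rightarrow> ('a \<Rightarrow> 'c) \<Rightarrow> 'd measure \<Rightarrow> ('a \<Rightarrow> 'd) \<Rightarrow> bool"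
where
  "cond_indep M MX X MZ Z MW W \<longleftrightarrow>
     X \<in> measurable M MX \<and> Z \<in> measurable M MZ \<and> W \<in> measurable M MW \<and>
     (let F = vimage_algebra (space M) W MW in
       \<forall>A\<in>sets MX. \<forall>B\<in>sets MZ. AE z in M.
         real_cond_exp M F (indicator (X -` A \<inter> Z -` B \<inter> space M)) z =
         real_cond_exp M F (indicator (X -` A \<inter> space M)) z *
         real_cond_exp M F (indicator (Z -` B \<inter> space M)) z)"


section \<open>Sequential teams\<close>

text \<open>Standard Borel spaces are Borel subsets of Polish types, with the subspace topology. The
  decision makers are numbered from \<open>1\<close> to \<open>horizon\<close>. A history \<open>(\<omega>, y, u)\<close> consists of the
  primitive variable and of the families of past measurements and actions, which are extensional
  functions of the index. The kernel of decision maker \<open>t\<close> takes a history with \<open>t - 1\<close>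
  measurements and \<open>t - 1\<close> actions.\<close>

record ('w, 'y, 'u) team =
  horizon :: nat
  Omega :: "'w set"
  Omega_law :: "'w measure"
  Y :: "nat \<Rightarrow> 'y set"
  U :: "nat \<Rightarrow> 'u set"
  kernel :: "nat \<Rightarrow> 'w \<times> (nat \<Rightarrow> 'y) \<times> (nat \<Rightarrow> 'u) \<Rightarrow> 'y measure"
  cost :: "'w \<times> (nat \<Rightarrow> 'u) \<Rightarrow> real"

abbreviation borel_on :: "'a::topological_space set \<Rightarrow> 'a measure" where
  "borel_on S \<equiv> restrict_space borel S"

text \<open>Histories with \<open>m\<close> measurements and \<open>k\<close> actions.\<close>

definition hist :: "('w::polish_space, 'y::polish_space, 'u::polish_space) team \<Rightarrow> nat \<Rightarrow> nat \<Rightarrow>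
    ('w \<times> (nat \<Rightarrow> 'y) \<times> (nat \<Rightarrow> 'u)) measure" where
  "hist T m k = borel_on (Omega T) \<Otimes>\<^sub>M
     (Pi\<^sub>M {1..m} (\<lambda>i. borel_on (Y T i)) \<Otimes>\<^sub>M Pi\<^sub>M {1..k} (\<lambda>i. borel_on (U T i)))"

definition hist_top :: "('w::polish_space, 'y::polish_space, 'u::polish_space) team \<Rightarrow> nat \<Rightarrow> nat \<Rightarrow>
    ('w \<times> (nat \<Rightarrow> 'y) \<times> (nat \<Rightarrow> 'u)) topology" where
  "hist_top T m k = prod_topology (top_of_set (Omega T))
     (prod_topology (product_topology (\<lambda>i. top_of_set (Y T i)) {1..m})
                    (product_topology (\<lambda>i. top_of_set (U T i)) {1..k}))"

definition sequential_team ::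
  "('w::polish_space, 'y::polish_space, 'u::polish_space) team \<Rightarrow> bool" where
  "sequential_team T \<longleftrightarrow>
     Omega T \<in> sets borel \<and>
     (\<forall>t\<in>{1..horizon T}. Y T t \<in> sets borel \<and> Y T t \<noteq> {} \<and> U T t \<in> sets borel \<and> U T t \<noteq> {}) \<and>
     Omega_law T \<in> space (prob_algebra (borel_on (Omega T))) \<and>
     (\<forall>t\<in>{1..horizon T}.
        kernel T t \<in> hist T (t - 1) (t - 1) \<rightarrow>\<^sub>M prob_algebra (borel_on (Y T t))) \<and>
     cost T \<in> borel_measurable
       (borel_on (Omega T) \<Otimes>\<^sub>M Pi\<^sub>M {1..horizon T} (\<lambda>i. borel_on (U T i))) \<and>
     (\<forall>z\<in>Omega T \<times> (\<Pi>\<^sub>E i\<in>{1..horizon T}. U T i). 0 \<le> cost T z)"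


section \<open>Extended states and actions\<close>

text \<open>An extended state \<open>\<pi>\<^sub>n\<close> lives on \<open>hist T n (n - 1)\<close>, an extended action on \<open>hist T n n\<close>.\<close>

definition admissible :: "('w::polish_space, 'y::polish_space, 'u::polish_space) team \<Rightarrow> nat \<Rightarrow>
    (('w \<times> (nat \<Rightarrow> 'y) \<times> (nat \<Rightarrow> 'u)) measure \<times> ('w \<times> (nat \<Rightarrow> 'y) \<times> (nat \<Rightarrow> 'u)) measure) set"
where
  "admissible T n = {(\<pi>, g).
     \<pi> \<in> space (prob_algebra (hist T n (n - 1))) \<and>
     g \<in> space (prob_algebra (hist T n n)) \<and>
     (let x = (\<lambda>(\<omega>, y, u). (\<omega>, y, restrict u {1..n - 1})) in
        distr g (hist T n (n - 1)) x = \<pi> \<and>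
        cond_indep g (hist T n (n - 1)) x
          (borel_on (U T n)) (\<lambda>(\<omega>, y, u). u n)
          (borel_on (Y T n)) (\<lambda>(\<omega>, y, u). y n))}"

text \<open>The law of \<open>(x\<^sub>n, u\<^sup>n, y\<^sup>n\<^sup>+\<^sup>1)\<close> when \<open>(x\<^sub>n, u\<^sup>n)\<close> has law \<open>g\<close>; the first component of the
  pair \<open>(\<pi>\<^sub>n, g)\<close> is a marginal of \<open>g\<close> and so is not needed.\<close>

definition next_state :: "('w::polish_space, 'y::polish_space, 'u::polish_space) team \<Rightarrow> nat \<Rightarrow>
    ('w \<times> (nat \<Rightarrow> 'y) \<times> (nat \<Rightarrow> 'u)) measure \<Rightarrow> ('w \<times> (nat \<Rightarrow> 'y) \<times> (nat \<Rightarrow> 'u)) measure" where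
  "next_state T n g = g \<bind>
     (\<lambda>(\<omega>, y, u). distr (kernel T (Suc n) (\<omega>, y, u)) (hist T (Suc n) n)
        (\<lambda>y'. (\<omega>, y(Suc n := y'), u)))"

text \<open>As \<open>\<pi>\<^sub>n\<^sub>+\<^sub>1\<close> is a deterministic function of \<open>(\<pi>\<^sub>n, g)\<close>, the conditional expectation of
  \<open>\<integral>f d\<pi>\<^sub>n\<^sub>+\<^sub>1\<close> given \<open>(\<pi>\<^sub>n, g)\<close> is the integral itself.\<close>

definition weakly_continuous_transitions ::
  "('w::polish_space, 'y::polish_space, 'u::polish_space) team \<Rightarrow> bool" where
  "weakly_continuous_transitions T \<longleftrightarrow>
     (\<forall>n\<in>{1..<horizon T}. \<forall>f.
        continuous_map (hist_top T (Suc n) n) euclideanreal f \<and>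
        bounded (f ` topspace (hist_top T (Suc n) n)) \<longrightarrow>
        continuous_map
          (subtopology
             (prod_topology (weak_topology (hist T n (n - 1)) (hist_top T n (n - 1)))
                            (weak_topology (hist T n n) (hist_top T n n)))
             (admissible T n))
          euclideanreal
          (\<lambda>(\<pi>, g). \<integral>z. f z \<partial>next_state T n g))"


section \<open>Policies\<close>

definition team_policies :: "('w, 'y::polish_space, 'u::polish_space) team \<Rightarrow>
    (nat \<Rightarrow> 'y \<Rightarrow> 'u) set" where
  "team_policies T =
     {\<gamma>. \<forall>t\<in>{1..horizon T}. \<gamma> t \<in> borel_on (Y T t) \<rightarrow>\<^sub>M borel_on (U T t)}"

text \<open>The law of \<open>(\<omega>\<^sub>0, y\<^sup>1, \<dots>, y\<^sup>n, u\<^sup>1, \<dots>, u\<^sup>n)\<close> under the policy \<open>\<gamma>\<close>.\<close>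

primrec policy_law :: "('w::polish_space, 'y::polish_space, 'u::polish_space) team \<Rightarrow>
    (nat \<Rightarrow> 'y \<Rightarrow> 'u) \<Rightarrow> nat \<Rightarrow> ('w \<times> (nat \<Rightarrow> 'y) \<times> (nat \<Rightarrow> 'u)) measure" where
  "policy_law T \<gamma> 0 =
     distr (Omega_law T) (hist T 0 0) (\<lambda>\<omega>. (\<omega>, \<lambda>_. undefined, \<lambda>_. undefined))"
| "policy_law T \<gamma> (Suc n) =
     distr (next_state T n (policy_law T \<gamma> n)) (hist T (Suc n) (Suc n))
       (\<lambda>(\<omega>, y, u). (\<omega>, y, u(Suc n := \<gamma> (Suc n) (y (Suc n)))))"

definition expected_cost :: "('w::polish_space, 'y::polish_space, 'u::polish_space) team \<Rightarrow>
    (nat \<Rightarrow> 'y \<Rightarrow> 'u) \<Rightarrow> ennreal" where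
  "expected_cost T \<gamma> = (\<integral>\<^sup>+(\<omega>, y, u). ennreal (cost T (\<omega>, u)) \<partial>policy_law T \<gamma> (horizon T))"

definition optimal_policy :: "('w::polish_space, 'y::polish_space, 'u::polish_space) team \<Rightarrow>
    (nat \<Rightarrow> 'y \<Rightarrow> 'u) \<Rightarrow> bool" where
  "optimal_policy T \<gamma> \<longleftrightarrow>
     \<gamma> \<in> team_policies T \<and> expected_cost T \<gamma> = (INF \<gamma>'\<in>team_policies T. expected_cost T \<gamma>')"

text \<open>Some decision maker \<open>s\<close> can, by a change of its own policy alone, change the joint law of the
  primitive variable and the measurements. Since \<open>y\<^sup>1, \<dots>, y\<^sup>s\<close> are generated before \<open>u\<^sup>s\<close>, it is
  then the measurement of a later decision maker that is affected. The joint law, rather than the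
  kernels, is compared so that a dependence on actions confined to null sets does not count.\<close>

definition dynamic_team ::
  "('w::polish_space, 'y::polish_space, 'u::polish_space) team \<Rightarrow> bool" where
  "dynamic_team T \<longleftrightarrow>
     (\<exists>s\<in>{1..horizon T}. \<exists>\<gamma>\<in>team_policies T. \<exists>\<gamma>'\<in>team_policies T.
        (\<forall>t. t \<noteq> s \<longrightarrow> \<gamma> t = \<gamma>' t) \<and>
        (let M = borel_on (Omega T) \<Otimes>\<^sub>M Pi\<^sub>M {1..horizon T} (\<lambda>i. borel_on (Y T i));
             obs = (\<lambda>(\<omega>, y, u). (\<omega>, y))
         in distr (policy_law T \<gamma> (horizon T)) M obs \<noteq>
            distr (policy_law T \<gamma>' (horizon T)) M obs))"

end

theory Submission
  imports Defs
begin

text \<open>The counterexample is a team that can signal at an arbitrarily small price, but not for free.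
  The primitive variable \<open>\<omega>\<close> is a fair coin with values \<open>0\<close> and \<open>1\<close>. The first decision maker
  sees \<open>\<omega>\<close> and chooses \<open>u\<^sup>1 \<in> [0, 1]\<close>; the second sees exactly \<open>u\<^sup>1\<close> and chooses
  \<open>u\<^sup>2 \<in> [0, 1]\<close>; the cost is \<open>u\<^sup>1 + \<bar>u\<^sup>2 - \<omega>\<bar>\<close>. With \<open>u\<^sup>1 = \<epsilon> \<omega>\<close> and \<open>u\<^sup>2 = 1\<close> if
  \<open>u\<^sup>1 > 0\<close>, \<open>u\<^sup>2 = 0\<close> otherwise, the second decision maker recovers \<open>\<omega>\<close> and the expected cost is
  \<open>\<epsilon> / 2\<close>. So the infimum is \<open>0\<close>. Zero cost would force \<open>u\<^sup>1 = 0\<close> for both values of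
  \<open>\<omega>\<close>, hence a constant measurement \<open>y\<^sup>2 = 0\<close>, while the single action \<open>u\<^sup>2\<close> taken on seeing it
  would have to be equal to \<open>0\<close> and to \<open>1\<close> (\<open>no_optimal_policy\<close>). What fails is that the
  information structure is not closed: as \<open>\<epsilon>\<close> tends to \<open>0\<close> the joint laws converge weakly to one
  under which \<open>u\<^sup>2\<close> depends on \<open>\<omega>\<close> although \<open>y\<^sup>2\<close> carries no information.

  The hypotheses (a)--(c) hold because the measurements are continuous functions of the history. For
  such teams the next extended state is the image of the extended action under a continuous map
  (\<open>next_state_deterministic\<close>), and taking images under a continuous map is weakly continuous
  (\<open>weakly_continuous_transitions_deterministic\<close>). The law of the whole history under a policy is
  likewise the image of the law of \<open>\<omega>\<close> under the closed loop map
  (\<open>policy_law_deterministic\<close>), so that every expected cost is an average of two numbers.\<close>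

section \<open>Continuous functions of histories are measurable\<close>

text \<open>Histories with finitely many entries sit inside the space of all sequences, which is Polish.
  The three inclusion lemmas below compare topologies and \<open>\<sigma>\<close>-algebras across this embedding.\<close>

lemma continuous_map_PiE_inclusion:
  fixes Y :: "'i \<Rightarrow> 'a::topological_space set"
  shows "continuous_map (top_of_set (Pi\<^sub>E I Y)) (product_topology (\<lambda>i. top_of_set (Y i)) I) (\<lambda>y. y)"
proof (rule continuous_map_coordinatewise_then_product)
  fix i assume i: "i \<in> I"
  have "continuous_on (Pi\<^sub>E I Y) (\<lambda>y. y i)"
    by (rule continuous_on_product_coordinates[THEN continuous_on_subset]) auto
  then show "continuous_map (top_of_set (Pi\<^sub>E I Y)) (top_of_set (Y i)) (\<lambda>y. y i)"
    using i by auto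
qed (auto simp: PiE_def extensional_def)

lemma continuous_map_prod_inclusion:
  assumes "continuous_map A A' (\<lambda>x. x)" "continuous_map B B' (\<lambda>y. y)"
  shows "continuous_map (prod_topology A B) (prod_topology A' B') (\<lambda>z. z)"
  using continuous_map_prod_top[of A B A' B' "\<lambda>x. x" "\<lambda>y. y"] assms
  by (simp add: id_def)

lemma measurable_PiM_inclusion:
  fixes Y :: "'i::countable \<Rightarrow> 'a::second_countable_topology set"
  shows "(\<lambda>y. y) \<in> Pi\<^sub>M I (\<lambda>i. borel_on (Y i)) \<rightarrow>\<^sub>M borel"
proof (rule measurable_coordinatewise_then_product)
  fix i
  show "(\<lambda>y. y i) \<in> Pi\<^sub>M I (\<lambda>i. borel_on (Y i)) \<rightarrow>\<^sub>M borel"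
  proof (cases "i \<in> I")
    case True
    then have "(\<lambda>y. y i) \<in> Pi\<^sub>M I (\<lambda>i. borel_on (Y i)) \<rightarrow>\<^sub>M borel_on (Y i)"
      by (rule measurable_component_singleton)
    then show ?thesis
      by (simp add: measurable_restrict_space2_iff)
  next
    case False
    then have "y i = undefined" if "y \<in> space (Pi\<^sub>M I (\<lambda>i. borel_on (Y i)))" for y
      using that by (auto simp: space_PiM PiE_def extensional_def)
    then show ?thesis
      by (subst measurable_cong[where g = "\<lambda>_. undefined"]) auto
  qed
qed

lemma space_hist:
  "space (hist T m k) = Omega T \<times> (\<Pi>\<^sub>E i\<in>{1..m}. Y T i) \<times> (\<Pi>\<^sub>E i\<in>{1..k}. U T i)"
  by (simp add: hist_def space_pair_measure space_PiM space_restrict_space)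

lemma topspace_hist_top: "topspace (hist_top T m k) = space (hist T m k)"
  by (simp add: hist_top_def space_hist)

text \<open>A change of variables in \<open>\<integral>f d\<pi>\<^sub>n\<^sub>+\<^sub>1\<close> needs \<open>f\<close> to be measurable, whereas the test functions of
  weak convergence are only known to be continuous, and for the product topology rather than the
  product \<open>\<sigma>\<close>-algebra. Both structures on histories are traces of those of a second countable
  space, where the product \<open>\<sigma>\<close>-algebra is the Borel one; the claim is therefore an instance of
  the measurability of continuous functions.\<close>

lemma continuous_hist_measurable:
  fixes T :: "('w::polish_space, 'y::polish_space, 'u::polish_space) team"
  assumes f: "continuous_map (hist_top T m k) (top_of_set S) f"
  shows "f \<in> hist T m k \<rightarrow>\<^sub>M borel_on S"
proof -
  define H where "H = space (hist T m k)"
  have incl: "continuous_map (top_of_set H) (hist_top T m k) (\<lambda>z. z)"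
  proof -
    have H: "top_of_set H = prod_topology (top_of_set (Omega T))
        (prod_topology (top_of_set (\<Pi>\<^sub>E i\<in>{1..m}. Y T i)) (top_of_set (\<Pi>\<^sub>E i\<in>{1..k}. U T i)))"
      by (simp add: H_def space_hist flip: prod_topology_subtopology_eu)
    show ?thesis
      unfolding H hist_top_def
      by (intro continuous_map_prod_inclusion continuous_map_PiE_inclusion) simp
  qed
  have "continuous_map (top_of_set H) (top_of_set S) f"
    using continuous_map_compose[OF incl f] by (simp add: comp_def)
  then have cont: "continuous_on H f" and im: "f \<in> H \<rightarrow> S"
    by auto
  have "(\<lambda>z. z) \<in> hist T m k \<rightarrow>\<^sub>M borel"
  proof -
    \<comment> \<open>The components are kept apart until \<open>borel_prod\<close> merges the three Borel \<open>\<sigma>\<close>-algebras into one,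
      which is where second countability enters.\<close>
    have "(\<lambda>z. (fst z, fst (snd z), snd (snd z))) \<in> hist T m k \<rightarrow>\<^sub>M borel \<Otimes>\<^sub>M borel \<Otimes>\<^sub>M borel"
      unfolding hist_def
      by (intro measurable_Pair measurable_compose[OF _ measurable_PiM_inclusion[of "{1..m}" "Y T"]]
            measurable_compose[OF _ measurable_PiM_inclusion[of "{1..k}" "U T"]]
            measurable_compose[OF measurable_fst measurable_restrict_space1[OF measurable_ident_sets[OF refl]]])
        simp_all
    then show ?thesis
      by (simp add: borel_prod)
  qed
  then have "(\<lambda>z. z) \<in> hist T m k \<rightarrow>\<^sub>M borel_on H"
    by (auto intro!: measurable_restrict_space2 simp: H_def)
  moreover have "f \<in> borel_on H \<rightarrow>\<^sub>M borel_on S"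
    using borel_measurable_continuous_on_restrict[OF cont] im
    by (auto intro!: measurable_restrict_space2 simp: space_restrict_space)
  ultimately show ?thesis
    by (rule measurable_compose)
qed

section \<open>Deterministic measurements\<close>

text \<open>A closed loop step splits into the arrival of the measurement \<open>y\<^sup>n\<^sup>+\<^sup>1 = h(x\<^sub>n, u\<^sup>n)\<close> and the
  reaction to it.\<close>

definition observe ::
  "nat \<Rightarrow> ('w \<times> (nat \<Rightarrow> 'y) \<times> (nat \<Rightarrow> 'u) \<Rightarrow> 'y) \<Rightarrow>
     'w \<times> (nat \<Rightarrow> 'y) \<times> (nat \<Rightarrow> 'u) \<Rightarrow> 'w \<times> (nat \<Rightarrow> 'y) \<times> (nat \<Rightarrow> 'u)" where
  "observe n h = (\<lambda>(\<omega>, y, u). (\<omega>, y(Suc n := h (\<omega>, y, u)), u))"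

definition act ::
  "nat \<Rightarrow> (nat \<Rightarrow> 'y \<Rightarrow> 'u) \<Rightarrow>
     'w \<times> (nat \<Rightarrow> 'y) \<times> (nat \<Rightarrow> 'u) \<Rightarrow> 'w \<times> (nat \<Rightarrow> 'y) \<times> (nat \<Rightarrow> 'u)" where
  "act n \<gamma> = (\<lambda>(\<omega>, y, u). (\<omega>, y, u(Suc n := \<gamma> (Suc n) (y (Suc n)))))"

lemma measurable_observe:
  assumes [measurable]: "h \<in> hist T n n \<rightarrow>\<^sub>M borel_on (Y T (Suc n))"
  shows "observe n h \<in> hist T n n \<rightarrow>\<^sub>M hist T (Suc n) n"
proof -
  have "(\<lambda>z. (fst z, (fst (snd z))(Suc n := h z), snd (snd z))) \<in> hist T n n \<rightarrow>\<^sub>M hist T (Suc n) n"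
    unfolding hist_def[of T "Suc n" n]
  proof (intro measurable_Pair measurable_fun_upd)
    show "{1..Suc n} = {1..n} \<union> {Suc n}" by auto
  qed (use assms in \<open>auto simp: hist_def\<close>)
  then show ?thesis
    by (simp add: observe_def case_prod_beta')
qed

lemma measurable_act:
  assumes "\<gamma> (Suc n) \<in> borel_on (Y T (Suc n)) \<rightarrow>\<^sub>M borel_on (U T (Suc n))"
  shows "act n \<gamma> \<in> hist T (Suc n) n \<rightarrow>\<^sub>M hist T (Suc n) (Suc n)"
proof -
  have "(\<lambda>z. (fst z, fst (snd z), (snd (snd z))(Suc n := \<gamma> (Suc n) (fst (snd z) (Suc n)))))
      \<in> hist T (Suc n) n \<rightarrow>\<^sub>M hist T (Suc n) (Suc n)"
    unfolding hist_def[of T "Suc n" "Suc n"]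
  proof (intro measurable_Pair measurable_fun_upd measurable_compose[OF _ assms])
    show "{1..Suc n} = {1..n} \<union> {Suc n}" by auto
    have "(\<lambda>z. fst (snd z)) \<in> hist T (Suc n) n \<rightarrow>\<^sub>M Pi\<^sub>M {1..Suc n} (\<lambda>i. borel_on (Y T i))"
      by (simp add: hist_def)
    then show "(\<lambda>z. fst (snd z) (Suc n)) \<in> hist T (Suc n) n \<rightarrow>\<^sub>M borel_on (Y T (Suc n))"
      by (rule measurable_compose) (rule measurable_component_singleton, simp)
  qed (auto simp: hist_def)
  then show ?thesis
    by (simp add: act_def case_prod_beta')
qed

text \<open>A Dirac kernel turns the mixture that defines the next state into an image measure.\<close>

lemma next_state_deterministic:
  assumes h: "h \<in> hist T n n \<rightarrow>\<^sub>M borel_on (Y T (Suc n))"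
    and kernel: "\<And>z. z \<in> space (hist T n n) \<Longrightarrow>
      kernel T (Suc n) z = return (borel_on (Y T (Suc n))) (h z)"
    and g: "g \<in> space (prob_algebra (hist T n n))"
  shows "next_state T n g = distr g (hist T (Suc n) n) (observe n h)"
proof -
  from g have sets: "sets g = sets (hist T n n)" and "prob_space g"
    by (auto simp: space_prob_algebra)
  then interpret prob_space g by simp
  have space: "space g = space (hist T n n)"
    by (rule sets_eq_imp_space_eq[OF sets])
  have "next_state T n g = g \<bind> (\<lambda>z. return (hist T (Suc n) n) (observe n h z))"
    unfolding next_state_def
  proof (rule bind_cong[OF refl])
    fix z assume "z \<in> space g"
    then have z: "z \<in> space (hist T n n)"
      by (simp add: space)
    obtain \<omega> y u where [simp]: "z = (\<omega>, y, u)"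
      by (cases z)
    have "(\<lambda>y'. (\<omega>, y(Suc n := y'), u)) \<in> borel_on (Y T (Suc n)) \<rightarrow>\<^sub>M hist T (Suc n) n"
      unfolding hist_def
    proof (intro measurable_Pair measurable_fun_upd)
      show "{1..Suc n} = {1..n} \<union> {Suc n}" by auto
    qed (use z in \<open>auto simp: space_hist space_PiM space_restrict_space intro!: measurable_const\<close>)
    then have "distr (return (borel_on (Y T (Suc n))) (h z)) (hist T (Suc n) n)
        (\<lambda>y'. (\<omega>, y(Suc n := y'), u)) = return (hist T (Suc n) n) (\<omega>, y(Suc n := h z), u)"
      using measurable_space[OF h z] by (rule distr_return)
    then show "(case z of (\<omega>, y, u) \<Rightarrow> distr (kernel T (Suc n) (\<omega>, y, u)) (hist T (Suc n) n)
          (\<lambda>y'. (\<omega>, y(Suc n := y'), u))) = return (hist T (Suc n) n) (observe n h z)"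
      using kernel[OF z] by (simp add: observe_def)
  qed
  also have "\<dots> = distr g (hist T (Suc n) n) (observe n h)"
    using measurable_observe[OF h] not_empty
    by (intro bind_return_distr') (auto cong: measurable_cong_sets simp: measurable_cong_sets[OF sets refl])
  finally show ?thesis .
qed

text \<open>If the history after \<open>n\<close> steps is a function \<open>X\<close> of some random element with law \<open>P\<close>, then so is
  the history after \<open>n + 1\<close> steps. Iterated from \<open>n = 0\<close>, where \<open>P\<close> is the law of the primitive
  variable, this removes all intermediate measures.\<close>

lemma policy_law_deterministic:
  assumes h: "h \<in> hist T n n \<rightarrow>\<^sub>M borel_on (Y T (Suc n))"
    and kernel: "\<And>z. z \<in> space (hist T n n) \<Longrightarrow>
      kernel T (Suc n) z = return (borel_on (Y T (Suc n))) (h z)"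
    and \<gamma>: "\<gamma> (Suc n) \<in> borel_on (Y T (Suc n)) \<rightarrow>\<^sub>M borel_on (U T (Suc n))"
    and P: "prob_space P"
    and X: "X \<in> P \<rightarrow>\<^sub>M hist T n n"
    and law: "policy_law T \<gamma> n = distr P (hist T n n) X"
  shows "policy_law T \<gamma> (Suc n) = distr P (hist T (Suc n) (Suc n)) (act n \<gamma> \<circ> observe n h \<circ> X)"
    and "act n \<gamma> \<circ> observe n h \<circ> X \<in> P \<rightarrow>\<^sub>M hist T (Suc n) (Suc n)"
proof -
  note [measurable] = X measurable_observe[OF h] measurable_act[of \<gamma>, OF \<gamma>]
  have "policy_law T \<gamma> n \<in> space (prob_algebra (hist T n n))"
    unfolding law using prob_space.prob_space_distr[OF P X] by (simp add: space_prob_algebra)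
  from next_state_deterministic[OF h kernel this]
  have "policy_law T \<gamma> (Suc n) =
      distr (distr (distr P (hist T n n) X) (hist T (Suc n) n) (observe n h))
        (hist T (Suc n) (Suc n)) (act n \<gamma>)"
    by (simp add: law act_def)
  then show "policy_law T \<gamma> (Suc n) = distr P (hist T (Suc n) (Suc n)) (act n \<gamma> \<circ> observe n h \<circ> X)"
    by (simp add: distr_distr comp_assoc)
  show "act n \<gamma> \<circ> observe n h \<circ> X \<in> P \<rightarrow>\<^sub>M hist T (Suc n) (Suc n)"
    by measurable
qed

section \<open>Weak continuity\<close>

lemma continuous_map_weak_integral:
  assumes f: "continuous_map X euclideanreal f" "bounded (f ` topspace X)"
  shows "continuous_map (weak_topology M X) euclideanreal (\<lambda>\<mu>. \<integral>x. f x \<partial>\<mu>)"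
proof -
  let ?B = "{{\<mu> \<in> space (prob_algebra M). (\<integral>x. f x \<partial>\<mu>) \<in> V} | f V.
        continuous_map X euclideanreal f \<and> bounded (f ` topspace X) \<and> open (V :: real set)}"
  have top: "topspace (weak_topology M X) \<subseteq> space (prob_algebra M)"
    unfolding weak_topology_def topology_generated_by_topspace by auto
  have gen: "openin (weak_topology M X) {\<mu> \<in> space (prob_algebra M). (\<integral>x. f x \<partial>\<mu>) \<in> V}"
    if "open V" for V
    unfolding weak_topology_def using f that by (intro topology_generated_by_Basis) blast
  have "{\<mu> \<in> topspace (weak_topology M X). (\<integral>x. f x \<partial>\<mu>) \<in> V}
      = {\<mu> \<in> space (prob_algebra M). (\<integral>x. f x \<partial>\<mu>) \<in> V}" if "open V" for V
    using top openin_subset[OF gen[OF that]] by blast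
  with gen show ?thesis
    unfolding continuous_map_def by auto
qed

lemma continuous_map_observe:
  assumes h: "continuous_map (hist_top T n n) (top_of_set (Y T (Suc n))) h"
  shows "continuous_map (hist_top T n n) (hist_top T (Suc n) n) (observe n h)"
proof -
  have "continuous_map (hist_top T n n) (hist_top T (Suc n) n)
      (\<lambda>z. (fst z, (fst (snd z))(Suc n := h z), snd (snd z)))"
    unfolding hist_top_def[of T "Suc n" n]
  proof (rule continuous_map_pairedI[OF _ continuous_map_pairedI[OF continuous_map_coordinatewise_then_product]])
    have y: "continuous_map (hist_top T n n) (product_topology (\<lambda>i. top_of_set (Y T i)) {1..n})
        (\<lambda>z. fst (snd z))"
      unfolding hist_top_def
      using continuous_map_compose[OF continuous_map_snd continuous_map_fst] by (simp add: comp_def)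
    fix i assume "i \<in> {1..Suc n}"
    then consider "i = Suc n" | "i \<in> {1..n}" by fastforce
    then show "continuous_map (hist_top T n n) (top_of_set (Y T i)) (\<lambda>z. ((fst (snd z))(Suc n := h z)) i)"
    proof cases
      case 1
      then show ?thesis using h by simp
    next
      case 2
      then show ?thesis
        using continuous_map_product_then_coordinatewise(1)[OF y 2] by auto
    qed
  next
    fix i z assume "i \<notin> {1..Suc n}" "z \<in> topspace (hist_top T n n)"
    then show "((fst (snd z))(Suc n := h z)) i = undefined"
      by (auto simp: topspace_hist_top space_hist PiE_def extensional_def)
  next
    show "continuous_map (hist_top T n n) (top_of_set (Omega T)) fst"
      unfolding hist_top_def by (rule continuous_map_fst)
    show "continuous_map (hist_top T n n) (product_topology (\<lambda>i. top_of_set (U T i)) {1..n})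
        (\<lambda>z. snd (snd z))"
      unfolding hist_top_def
      using continuous_map_compose[OF continuous_map_snd continuous_map_snd] by (simp add: comp_def)
  qed
  then show ?thesis
    by (simp add: observe_def case_prod_beta')
qed

text \<open>Composition of a bounded continuous \<open>f\<close> with the continuous map \<open>observe n (h n)\<close> is again a test
  function, and \<open>\<integral>f d\<pi>\<^sub>n\<^sub>+\<^sub>1\<close> is its integral against the extended action alone.\<close>

lemma weakly_continuous_transitions_deterministic:
  assumes h: "\<And>n. n \<in> {1..<horizon T} \<Longrightarrow>
      continuous_map (hist_top T n n) (top_of_set (Y T (Suc n))) (h n)"
    and kernel: "\<And>n z. \<lbrakk>n \<in> {1..<horizon T}; z \<in> space (hist T n n)\<rbrakk> \<Longrightarrow>
      kernel T (Suc n) z = return (borel_on (Y T (Suc n))) (h n z)"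
  shows "weakly_continuous_transitions T"
  unfolding weakly_continuous_transitions_def
proof (intro ballI allI impI, elim conjE)
  fix n f
  assume n: "n \<in> {1..<horizon T}"
    and f: "continuous_map (hist_top T (Suc n) n) euclideanreal f"
    and bdd: "bounded (f ` topspace (hist_top T (Suc n) n))"
  let ?W = "weak_topology (hist T n n) (hist_top T n n)"
  let ?P = "prod_topology (weak_topology (hist T n (n - 1)) (hist_top T n (n - 1))) ?W"
  note obs = continuous_map_observe[OF h[OF n]]
  have hm: "h n \<in> hist T n n \<rightarrow>\<^sub>M borel_on (Y T (Suc n))"
    by (rule continuous_hist_measurable[OF h[OF n]])
  have fm: "f \<in> borel_measurable (hist T (Suc n) n)"
    using continuous_hist_measurable[of T "Suc n" n UNIV f] f
    by (simp add: measurable_restrict_space2_iff)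
  have "(f \<circ> observe n (h n)) ` topspace (hist_top T n n) \<subseteq> f ` topspace (hist_top T (Suc n) n)"
    using continuous_map_image_subset_topspace[OF obs] by auto
  then have "continuous_map ?W euclideanreal (\<lambda>g. \<integral>z. (f \<circ> observe n (h n)) z \<partial>g)"
    by (intro continuous_map_weak_integral continuous_map_compose[OF obs f]
        bounded_subset[OF bdd])
  from continuous_map_compose[OF continuous_map_snd this]
  have "continuous_map (subtopology ?P (admissible T n)) euclideanreal
      ((\<lambda>g. \<integral>z. (f \<circ> observe n (h n)) z \<partial>g) \<circ> snd)"
    by (rule continuous_map_from_subtopology)
  then show "continuous_map (subtopology ?P (admissible T n)) euclideanreal
      (\<lambda>(\<pi>, g). \<integral>z. f z \<partial>next_state T n g)"
  proof (rule continuous_map_eq)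
    fix p assume "p \<in> topspace (subtopology ?P (admissible T n))"
    then have g: "snd p \<in> space (prob_algebra (hist T n n))"
      by (auto simp: admissible_def)
    then have "sets (snd p) = sets (hist T n n)"
      by (simp add: space_prob_algebra)
    then have "observe n (h n) \<in> snd p \<rightarrow>\<^sub>M hist T (Suc n) n"
      using measurable_observe[OF hm] by (simp cong: measurable_cong_sets)
    from integral_distr[OF this fm]
    show "((\<lambda>g. \<integral>z. (f \<circ> observe n (h n)) z \<partial>g) \<circ> snd) p =
        (case p of (\<pi>, g) \<Rightarrow> \<integral>z. f z \<partial>next_state T n g)"
      using next_state_deterministic[OF hm kernel[OF n] g]
      by (simp add: case_prod_beta)
  qed
qed


section \<open>A team that signals at small cost\<close>

text \<open>Two atoms suffice: any law of \<open>\<omega>\<close> with positive variance makes an uninformative measurement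
  costly.\<close>

definition coin :: "real measure" where
  "coin = distr (measure_pmf (bernoulli_pmf (1/2))) (borel_on {0..1}) of_bool"

text \<open>The first measurement is the primitive variable, every later one is the preceding action without
  noise. The index is the number of actions already taken, one less than the number of the decision
  maker who receives the signal.\<close>

definition signal :: "nat \<Rightarrow> real \<times> (nat \<Rightarrow> real) \<times> (nat \<Rightarrow> real) \<Rightarrow> real" where
  "signal n = (\<lambda>(\<omega>, y, u). if n = 0 then \<omega> else u n)"

definition signalling_team :: "(real, real, real) team" where
  "signalling_team = \<lparr>horizon = 2, Omega = {0..1}, Omega_law = coin,
     Y = (\<lambda>_. {0..1}), U = (\<lambda>_. {0..1}),
     kernel = (\<lambda>t z. return (borel_on {0..1}) (signal (t - 1) z)),
     cost = (\<lambda>(\<omega>, u). u 1 + \<bar>u 2 - \<omega>\<bar>)\<rparr>"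

lemma signalling_team_simps [simp]:
  "horizon signalling_team = 2" "Omega signalling_team = {0..1}"
  "Omega_law signalling_team = coin" "Y signalling_team t = {0..1}" "U signalling_team t = {0..1}"
  "kernel signalling_team t z = return (borel_on {0..1}) (signal (t - 1) z)"
  "cost signalling_team (\<omega>, u) = u 1 + \<bar>u 2 - \<omega>\<bar>"
  by (simp_all add: signalling_team_def)

lemma of_bool_measurable_unit:
  "(of_bool :: bool \<Rightarrow> real) \<in> measure_pmf p \<rightarrow>\<^sub>M borel_on {0..1}"
  by (auto intro!: measurable_restrict_space2)

lemma space_coin [simp]: "space coin = {0..1}" and sets_coin [simp]: "sets coin = sets (borel_on {0..1})"
  by (simp_all add: coin_def space_restrict_space)

lemma prob_space_coin: "prob_space coin"
  unfolding coin_def by (rule measure_pmf.prob_space_distr[OF of_bool_measurable_unit])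

lemma nn_integral_coin:
  assumes "\<And>x. x \<in> {0..1} \<Longrightarrow> 0 \<le> f x" "f \<in> borel_measurable (borel_on {0..1})"
  shows "(\<integral>\<^sup>+x. ennreal (f x) \<partial>coin) = ennreal ((f 0 + f 1) / 2)"
proof -
  have "(\<integral>\<^sup>+x. ennreal (f x) \<partial>coin) = (\<integral>\<^sup>+b. ennreal (f (of_bool b)) \<partial>measure_pmf (bernoulli_pmf (1/2)))"
    unfolding coin_def using assms(2) of_bool_measurable_unit
    by (subst nn_integral_distr) auto
  also have "\<dots> = ennreal (f 1) * ennreal (1/2) + ennreal (f 0) * ennreal (1/2)"
    by (subst nn_integral_bernoulli_pmf) (simp_all del: ennreal_half)
  also have "\<dots> = ennreal (f 1 * (1/2)) + ennreal (f 0 * (1/2))"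
    by (simp only: ennreal_mult''[of "1/2", symmetric] zero_le_divide_1_iff zero_le_numeral)
  also have "\<dots> = ennreal (f 1 * (1/2) + f 0 * (1/2))"
    using assms(1)[of 0] assms(1)[of 1] by (intro ennreal_plus[symmetric]) auto
  also have "f 1 * (1/2) + f 0 * (1/2) = (f 0 + f 1) / 2"
    by simp
  finally show ?thesis .
qed

lemma continuous_map_signal:
  "continuous_map (hist_top signalling_team n n) (top_of_set {0..1}) (signal n)"
proof (cases "n = 0")
  case True
  then show ?thesis
    using continuous_map_fst[of "top_of_set {0..1}"] by (simp add: hist_top_def signal_def case_prod_beta')
next
  case False
  have "continuous_map (hist_top signalling_team n n)
      (product_topology (\<lambda>i. top_of_set (U signalling_team i)) {1..n}) (\<lambda>z. snd (snd z))"
    unfolding hist_top_def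
    using continuous_map_compose[OF continuous_map_snd continuous_map_snd] by (simp add: comp_def)
  from continuous_map_product_then_coordinatewise(1)[OF this, of n] False
  show ?thesis
    by (simp add: signal_def case_prod_beta')
qed

lemma measurable_signal:
  "signal n \<in> hist signalling_team n n \<rightarrow>\<^sub>M borel_on (Y signalling_team (Suc n))"
  using continuous_hist_measurable[OF continuous_map_signal] by simp

lemma continuous_cost:
  "continuous_map
     (prod_topology (top_of_set (Omega signalling_team))
        (product_topology (\<lambda>i. top_of_set (U signalling_team i)) {1..horizon signalling_team}))
     euclideanreal (cost signalling_team)"
proof -
  let ?X = "prod_topology (top_of_set {0..1::real}) (product_topology (\<lambda>i. top_of_set {0..1::real}) {1..2::nat})"
  have \<omega>: "continuous_map ?X euclideanreal fst"
    using continuous_map_fst by (rule continuous_map_into_fulltopology)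
  have u: "continuous_map ?X euclideanreal (\<lambda>z. snd z i)" if "i \<in> {1..2}" for i
    using continuous_map_product_then_coordinatewise(1)[OF continuous_map_snd that]
    by (rule continuous_map_into_fulltopology)
  have "continuous_map ?X euclideanreal (\<lambda>z. snd z 1 + \<bar>snd z 2 - fst z\<bar>)"
    using \<omega> u by (intro continuous_map_add continuous_map_real_abs continuous_map_diff) auto
  then show ?thesis
    by (simp add: signalling_team_def case_prod_beta')
qed

lemma measurable_cost:
  "cost signalling_team \<in> borel_measurable
     (borel_on {0..1} \<Otimes>\<^sub>M Pi\<^sub>M {1..2} (\<lambda>i. borel_on {0..1}))"
proof -
  let ?X = "borel_on {0..1::real} \<Otimes>\<^sub>M Pi\<^sub>M {1..2::nat} (\<lambda>i. borel_on {0..1::real})"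
  have [measurable]: "fst \<in> borel_measurable ?X"
    using measurable_fst by (rule measurable_compose) (simp add: measurable_restrict_space1)
  have [measurable]: "(\<lambda>z. snd z i) \<in> borel_measurable ?X" if "i \<in> {1..2}" for i
  proof -
    have "(\<lambda>z. snd z i) \<in> ?X \<rightarrow>\<^sub>M borel_on {0..1}"
      by (rule measurable_compose[OF measurable_snd measurable_component_singleton[OF that]])
    then show ?thesis
      by (simp add: measurable_restrict_space2_iff)
  qed
  have "(\<lambda>z. snd z 1 + \<bar>snd z 2 - fst z\<bar>) \<in> borel_measurable ?X"
    by (intro borel_measurable_add borel_measurable_abs borel_measurable_diff) measurable
  then show ?thesis
    by (simp add: signalling_team_def case_prod_beta')
qed

lemma sequential_signalling_team: "sequential_team signalling_team"
  unfolding sequential_team_def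
proof (intro conjI ballI)
  fix t assume "t \<in> {1..horizon signalling_team}"
  then have t: "Suc (t - 1) = t" by simp
  show "kernel signalling_team t \<in> hist signalling_team (t - 1) (t - 1)
      \<rightarrow>\<^sub>M prob_algebra (borel_on (Y signalling_team t))"
    using measurable_compose[OF measurable_signal[of "t - 1"] measurable_return_prob_space]
    by (simp add: signalling_team_def)
next
  fix z assume "z \<in> Omega signalling_team \<times> (\<Pi>\<^sub>E i\<in>{1..horizon signalling_team}. U signalling_team i)"
  then show "0 \<le> cost signalling_team z"
    by (cases z) (auto simp: PiE_def Pi_def)
next
  show "Omega_law signalling_team \<in> space (prob_algebra (borel_on (Omega signalling_team)))"
    by (simp add: space_prob_algebra prob_space_coin)
qed (use measurable_cost in auto)

text \<open>Histories are extensional, so indices outside \<open>{1, 2}\<close> carry \<open>undefined\<close>.\<close>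

definition trajectory :: "(nat \<Rightarrow> real \<Rightarrow> real) \<Rightarrow> real \<Rightarrow> real \<times> (nat \<Rightarrow> real) \<times> (nat \<Rightarrow> real)" where
  "trajectory \<gamma> \<omega> = (\<omega>, (\<lambda>_. undefined)(1 := \<omega>, 2 := \<gamma> 1 \<omega>),
     (\<lambda>_. undefined)(1 := \<gamma> 1 \<omega>, 2 := \<gamma> 2 (\<gamma> 1 \<omega>)))"

lemma policy_law_signalling_team:
  assumes \<gamma>: "\<gamma> \<in> team_policies signalling_team"
  shows "policy_law signalling_team \<gamma> 2 = distr coin (hist signalling_team 2 2) (trajectory \<gamma>)"
    and "trajectory \<gamma> \<in> coin \<rightarrow>\<^sub>M hist signalling_team 2 2"
proof -
  have kernel: "kernel signalling_team (Suc n) z =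
      return (borel_on (Y signalling_team (Suc n))) (signal n z)" for n z
    by simp
  have \<gamma>': "\<gamma> (Suc n) \<in> borel_on (Y signalling_team (Suc n)) \<rightarrow>\<^sub>M borel_on (U signalling_team (Suc n))"
    if "n < 2" for n
    using \<gamma> that by (auto simp: team_policies_def)
  define start :: "real \<Rightarrow> real \<times> (nat \<Rightarrow> real) \<times> (nat \<Rightarrow> real)"
    where "start = (\<lambda>\<omega>. (\<omega>, \<lambda>_. undefined, \<lambda>_. undefined))"
  have start: "start \<in> coin \<rightarrow>\<^sub>M hist signalling_team 0 0"
    unfolding start_def hist_def
    by (intro measurable_Pair measurable_const) (auto simp: space_PiM measurable_ident_sets)
  have trajectory: "trajectory \<gamma> = act 1 \<gamma> \<circ> observe 1 (signal 1) \<circ> (act 0 \<gamma> \<circ> observe 0 (signal 0) \<circ> start)"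
    by (auto simp: trajectory_def act_def observe_def signal_def start_def fun_eq_iff numeral_2_eq_2)
  have step: "policy_law signalling_team \<gamma> (Suc n) =
        distr coin (hist signalling_team (Suc n) (Suc n)) (act n \<gamma> \<circ> observe n (signal n) \<circ> X) \<and>
      act n \<gamma> \<circ> observe n (signal n) \<circ> X \<in> coin \<rightarrow>\<^sub>M hist signalling_team (Suc n) (Suc n)"
    if "n < 2" "X \<in> coin \<rightarrow>\<^sub>M hist signalling_team n n"
      "policy_law signalling_team \<gamma> n = distr coin (hist signalling_team n n) X" for n X
    by (intro conjI policy_law_deterministic measurable_signal kernel \<gamma>' prob_space_coin that)
  have "policy_law signalling_team \<gamma> 0 = distr coin (hist signalling_team 0 0) start"
    by (simp add: start_def)
  with step[of 0 start] start
  have one: "policy_law signalling_team \<gamma> 1 =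
        distr coin (hist signalling_team 1 1) (act 0 \<gamma> \<circ> observe 0 (signal 0) \<circ> start)"
      "act 0 \<gamma> \<circ> observe 0 (signal 0) \<circ> start \<in> coin \<rightarrow>\<^sub>M hist signalling_team 1 1"
    by auto
  note two = step[of 1, OF _ one(2) one(1)]
  show "policy_law signalling_team \<gamma> 2 = distr coin (hist signalling_team 2 2) (trajectory \<gamma>)"
    and "trajectory \<gamma> \<in> coin \<rightarrow>\<^sub>M hist signalling_team 2 2"
    using two unfolding trajectory by (simp_all add: numeral_2_eq_2)
qed

lemma policy_maps_unit:
  assumes "\<gamma> \<in> team_policies signalling_team" "t \<in> {1..2}" "x \<in> {0..1}"
  shows "\<gamma> t x \<in> {0..1}"
proof -
  have "\<gamma> t \<in> borel_on {0..1} \<rightarrow>\<^sub>M borel_on {0..1}"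
    using assms(1,2) by (auto simp: team_policies_def)
  from measurable_space[OF this, of x] assms(3) show ?thesis
    by (simp add: space_restrict_space)
qed

lemma expected_cost_signalling_team:
  assumes \<gamma>: "\<gamma> \<in> team_policies signalling_team"
  shows "expected_cost signalling_team \<gamma> =
    ennreal ((\<gamma> 1 0 + \<bar>\<gamma> 2 (\<gamma> 1 0)\<bar> + (\<gamma> 1 1 + \<bar>\<gamma> 2 (\<gamma> 1 1) - 1\<bar>)) / 2)"
proof -
  let ?c = "\<lambda>(\<omega>, y, u). cost signalling_team (\<omega>, u)"
  have c: "?c \<in> borel_measurable (hist signalling_team 2 2)"
  proof -
    have "(\<lambda>z. (fst z, snd (snd z))) \<in> hist signalling_team 2 2 \<rightarrow>\<^sub>M
        borel_on {0..1} \<Otimes>\<^sub>M Pi\<^sub>M {1..2} (\<lambda>i. borel_on {0..1})"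
      by (simp add: hist_def)
    from measurable_compose[OF this measurable_cost] show ?thesis
      by (simp add: case_prod_beta')
  qed
  note trajectory = policy_law_signalling_team[OF \<gamma>]
  have eq: "?c (trajectory \<gamma> \<omega>) = \<gamma> 1 \<omega> + \<bar>\<gamma> 2 (\<gamma> 1 \<omega>) - \<omega>\<bar>" for \<omega>
    by (simp add: trajectory_def)
  have "expected_cost signalling_team \<gamma> = (\<integral>\<^sup>+\<omega>. ennreal (?c (trajectory \<gamma> \<omega>)) \<partial>coin)"
    unfolding expected_cost_def using c trajectory(2)
    by (simp add: trajectory(1) nn_integral_distr case_prod_beta')
  also have "\<dots> = ennreal ((?c (trajectory \<gamma> 0) + ?c (trajectory \<gamma> 1)) / 2)"
  proof (rule nn_integral_coin)
    show "(\<lambda>\<omega>. ?c (trajectory \<gamma> \<omega>)) \<in> borel_measurable (borel_on {0..1})"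
      using measurable_compose[OF trajectory(2) c] by (simp cong: measurable_cong_sets)
    fix \<omega> :: real assume "\<omega> \<in> {0..1}"
    then have "0 \<le> \<gamma> 1 \<omega>"
      using policy_maps_unit[OF \<gamma>, of 1 \<omega>] by simp
    then show "0 \<le> ?c (trajectory \<gamma> \<omega>)"
      unfolding eq by simp
  qed
  finally show ?thesis
    unfolding eq by simp
qed

text \<open>An optimal policy would cost at most as much as every signalling policy with amplitude \<open>\<epsilon>\<close>, hence
  nothing at all; but when \<open>u\<^sup>1\<close> costs nothing it transmits no information.\<close>

lemma no_optimal_policy: "\<not> optimal_policy signalling_team \<gamma>"
proof
  assume "optimal_policy signalling_team \<gamma>"
  then have \<gamma>: "\<gamma> \<in> team_policies signalling_team"
    and opt: "\<And>\<gamma>'. \<gamma>' \<in> team_policies signalling_team \<Longrightarrow>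
      expected_cost signalling_team \<gamma> \<le> expected_cost signalling_team \<gamma>'"
    by (auto simp: optimal_policy_def intro: INF_lower)
  have unit: "\<gamma> 1 0 \<in> {0..1}" "\<gamma> 1 1 \<in> {0..1}"
    using policy_maps_unit[OF \<gamma>, of 1] by auto
  define C where "C = \<gamma> 1 0 + \<bar>\<gamma> 2 (\<gamma> 1 0)\<bar> + (\<gamma> 1 1 + \<bar>\<gamma> 2 (\<gamma> 1 1) - 1\<bar>)"
  have small: "C \<le> \<epsilon>" if "0 < \<epsilon>" "\<epsilon> \<le> 1" for \<epsilon> :: real
  proof -
    \<comment> \<open>The signalling policy with amplitude \<open>\<epsilon>\<close>, whose expected cost is \<open>\<epsilon> / 2\<close>.\<close>
    define \<delta> :: "nat \<Rightarrow> real \<Rightarrow> real"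
      where "\<delta> = (\<lambda>t y. if t = 1 then \<epsilon> * y else of_bool (y > 0))"
    have "\<delta> \<in> team_policies signalling_team"
    proof -
      have "(\<lambda>y. \<epsilon> * y) \<in> borel_on {0..1} \<rightarrow>\<^sub>M borel_on {0..1}"
      proof (intro measurable_restrict_space2 measurable_restrict_space1)
        show "(\<lambda>y. \<epsilon> * y) \<in> space (borel_on {0..1}) \<rightarrow> {0..1}"
          using that by (auto simp: space_restrict_space intro: mult_le_one)
      qed measurable
      moreover have "(\<lambda>y::real. of_bool (y > 0) :: real) \<in> borel_on {0..1} \<rightarrow>\<^sub>M borel_on {0..1}"
        by (intro measurable_restrict_space2 measurable_restrict_space1) auto
      ultimately show ?thesis
        by (auto simp: team_policies_def \<delta>_def)
    qed
    with opt[OF this] expected_cost_signalling_team[OF \<gamma>] expected_cost_signalling_team[OF this] that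
    show ?thesis
      by (simp add: C_def \<delta>_def)
  qed
  have "C \<le> 0"
  proof (rule field_le_epsilon)
    fix e :: real assume "0 < e"
    then show "C \<le> 0 + e"
      using small[of "min e 1"] by auto
  qed
  \<comment> \<open>All four terms of \<open>C\<close> are nonnegative, so each of them vanishes, and the second decision maker
    would have to answer the same observation \<open>0\<close> by both \<open>0\<close> and \<open>1\<close>.\<close>
  then have "\<gamma> 1 0 = 0" "\<gamma> 1 1 = 0" "\<gamma> 2 (\<gamma> 1 0) = 0" "\<gamma> 2 (\<gamma> 1 1) = 1"
    using unit unfolding C_def by auto
  then show False
    by simp
qed

text \<open>If the first decision maker always plays the constant \<open>a\<close>, then \<open>y\<^sup>2 = a\<close>. So the mean of \<open>y\<^sup>2\<close>
  tells the laws of the observations for \<open>a = 0\<close> and \<open>a = 1\<close> apart.\<close>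

lemma dynamic_signalling_team: "dynamic_team signalling_team"
proof -
  define M where "M = borel_on {0..1::real} \<Otimes>\<^sub>M Pi\<^sub>M {1..2::nat} (\<lambda>i. borel_on {0..1::real})"
  define obs :: "real \<times> (nat \<Rightarrow> real) \<times> (nat \<Rightarrow> real) \<Rightarrow> real \<times> (nat \<Rightarrow> real)"
    where "obs = (\<lambda>(\<omega>, y, u). (\<omega>, y))"
  define \<gamma> :: "real \<Rightarrow> nat \<Rightarrow> real \<Rightarrow> real" where "\<gamma> a = (\<lambda>t y. if t = 1 then a else 0)" for a
  have \<gamma>: "\<gamma> a \<in> team_policies signalling_team" if "a \<in> {0..1}" for a
    using that by (auto simp: team_policies_def \<gamma>_def space_restrict_space intro!: measurable_const)
  have y2: "(\<integral>\<^sup>+z. ennreal (snd z 2) \<partial>distr (policy_law signalling_team (\<gamma> a) 2) M obs) = ennreal a"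
    if "a \<in> {0..1}" for a
  proof -
    note trajectory = policy_law_signalling_team[OF \<gamma>[OF that]]
    have obs: "obs \<in> hist signalling_team 2 2 \<rightarrow>\<^sub>M M"
      by (simp add: obs_def M_def hist_def case_prod_beta')
    have "(\<lambda>z. snd z 2) \<in> M \<rightarrow>\<^sub>M borel_on {0..1}"
      unfolding M_def
      by (rule measurable_compose[OF measurable_snd measurable_component_singleton]) simp
    then have "(\<lambda>z. snd z 2) \<in> borel_measurable M"
      by (simp add: measurable_restrict_space2_iff)
    then have "(\<lambda>z. ennreal (snd z 2)) \<in> borel_measurable M"
      by (rule measurable_compose[OF _ measurable_ennreal])
    then have "(\<integral>\<^sup>+z. ennreal (snd z 2) \<partial>distr (policy_law signalling_team (\<gamma> a) 2) M obs)
        = (\<integral>\<^sup>+\<omega>. ennreal (snd (obs (trajectory (\<gamma> a) \<omega>)) 2) \<partial>coin)"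
      using obs trajectory(2) by (simp add: trajectory(1) distr_distr nn_integral_distr)
    also have "\<dots> = (\<integral>\<^sup>+\<omega>. ennreal a \<partial>coin)"
      by (simp add: obs_def trajectory_def \<gamma>_def)
    also have "\<dots> = ennreal a"
      using prob_space.emeasure_space_1[OF prob_space_coin] by simp
    finally show ?thesis .
  qed
  have "distr (policy_law signalling_team (\<gamma> 0) 2) M obs \<noteq> distr (policy_law signalling_team (\<gamma> 1) 2) M obs"
    using y2[of 0] y2[of 1] by auto
  moreover have "\<forall>t. t \<noteq> 1 \<longrightarrow> \<gamma> 0 t = \<gamma> 1 t"
    by (simp add: \<gamma>_def)
  ultimately show ?thesis
    unfolding dynamic_team_def Let_def
    using \<gamma>[of 0] \<gamma>[of 1]
    by (intro bexI[of _ 1] bexI[of _ "\<gamma> 0"] bexI[of _ "\<gamma> 1"]) (simp_all add: M_def obs_def)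
qed

theorem theorem4p1:
  "\<exists>T :: (real, real, real) team.
     sequential_team T \<and> horizon T = 2 \<and> dynamic_team T \<and>
     weakly_continuous_transitions T \<and>
     compact (Omega T) \<and>
     (\<forall>t\<in>{1..horizon T}. compact (Y T t) \<and> compact (U T t)) \<and>
     continuous_map
       (prod_topology (top_of_set (Omega T))
          (product_topology (\<lambda>i. top_of_set (U T i)) {1..horizon T}))
       euclideanreal (cost T) \<and>
     \<not> (\<exists>\<gamma>. optimal_policy T \<gamma>)"
proof (intro exI[of _ signalling_team] conjI)
  show "weakly_continuous_transitions signalling_team"
    using weakly_continuous_transitions_deterministic[of signalling_team signal]
    by (simp add: continuous_map_signal)
  show "\<forall>t\<in>{1..horizon signalling_team}. compact (Y signalling_team t) \<and> compact (U signalling_team t)"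
    by simp
  show "\<not> (\<exists>\<gamma>. optimal_policy signalling_team \<gamma>)"
    using no_optimal_policy by blast
  show "compact (Omega signalling_team)"
    by simp
qed (rule sequential_signalling_team signalling_team_simps dynamic_signalling_team continuous_cost)+

end
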